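(* Let $G$ be a finite group, let $p$ be a prime, and let $\varphi \in \mathrm{IBr}(G)$ be an irreducible ($p$-)Brauer character of $G$. Let $G^o$ be the set of $p$-regular elements of $G$, and set $L(\varphi) = \langle g \in G^o \mid \varphi(g) = \varphi(1) \rangle$. Then $L(\varphi)$ is a normal subgroup of $G$. Moreover, if $K(\varphi)$ is the subgroup of $G$ containing $L(\varphi)$ defined by $K(\varphi)/L(\varphi) = \mathbf{O}_p(G/L(\varphi))$, then $K(\varphi) = \ker \varphi$.
   Context: All groups are finite. An element of $G$ is $p$-regular if its order is not divisible by $p$. Let $F$ be an algebraically closed field of characteristic $p$ (in the standard setup, an algebraic closure of $\mathbb{F}_p$, with a fixed isomorphism from the group of complex roots of unity of order prime to $p$ onto $F^\times$). The Brauer character $\varphi : G^o \to \mathbb{C}$ afforded by an $F$-representation $\mathcal{X}$ of $G$ is defined by $\varphi(g) = \eta_1 + \cdots + \eta_n$, where $\eta_1, \dots, \eta_n$ are the complex roots of unity corresponding to the eigenvalues of $\mathcal{X}(g)$ (with multiplicity). $\mathrm{IBr}(G)$ is the set of Brauer characters afforded by irreducible $F$-representations. For $\varphi \in \mathrm{IBr}(G)$, the kernel is $\ker \varphi = \{ g \in G \mid \mathcal{X}(g) = I \}$, where $\mathcal{X}$ is an irreducible $F$-representation of $G$ affording $\varphi$ (this is independent of the choice of $\mathcal{X}$). $\mathbf{O}_p(H)$ denotes the largest normal $p$-subgroup of $H$. *)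

theory Defs
  imports
    "HOL-Algebra.Coset"
    "HOL-Algebra.Generated_Groups"
    "HOL-Algebra.Multiplicative_Group"
    "Jordan_Normal_Form.VS_Connect"
    "Jordan_Normal_Form.Char_Poly"
begin

hide_const (open) Multiset.mult

definition p_regular :: "nat \<Rightarrow> ('a, 'b) monoid_scheme \<Rightarrow> 'a set" where
  "p_regular p G = {g \<in> carrier G. \<not> p dvd group.ord G g}"

definition p_core :: "nat \<Rightarrow> ('a, 'b) monoid_scheme \<Rightarrow> 'a set" where
  "p_core p H = (GREATEST N. N \<lhd> H \<and> (\<exists>k. card N = p ^ k))"


definition roots_of_unity_prime_to :: "nat \<Rightarrow> complex monoid" where
  "roots_of_unity_prime_to p =
     \<lparr>carrier = {z. \<exists>n>0. coprime n p \<and> z ^ n = 1}, mult = (*), one = 1\<rparr>"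

definition root_correspondence :: "nat \<Rightarrow> (complex \<Rightarrow> 'f::field) \<Rightarrow> bool" where
  "root_correspondence p \<theta> \<longleftrightarrow>
     \<theta> \<in> iso (roots_of_unity_prime_to p) (units_of (class_ring :: 'f ring))"


text \<open>The carrier of the group of units of \<^term>\<open>ring_mat TYPE('f::field) n ()\<close> is
  the general linear group of degree \<^term>\<open>n\<close> over the field.\<close>

definition representation ::
  "('a, 'b) monoid_scheme \<Rightarrow> nat \<Rightarrow> ('a \<Rightarrow> ('f::field) mat) \<Rightarrow> bool" where
  "representation G n X \<longleftrightarrow> X \<in> hom G (units_of (ring_mat TYPE('f) n ()))"

definition irreducible_representation ::
  "('a, 'b) monoid_scheme \<Rightarrow> nat \<Rightarrow> ('a \<Rightarrow> ('f::field) mat) \<Rightarrow> bool" where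
  "irreducible_representation G n X \<longleftrightarrow>
     representation G n X \<and> n > 0 \<and>
     (\<forall>W. VectorSpace.subspace (class_ring :: 'f ring) W (module_vec TYPE('f) n) \<longrightarrow>
        (\<forall>g\<in>carrier G. \<forall>w\<in>W. X g *\<^sub>v w \<in> W) \<longrightarrow>
        W = {0\<^sub>v n} \<or> W = carrier_vec n)"

text \<open>The eigenvalues with multiplicity are the roots of the characteristic polynomial.
  Brauer characters are functions on the \<open>p\<close>-regular elements only; in order that
  equality of functions be equality there, they are \<^const>\<open>undefined\<close> elsewhere.\<close>

definition brauer_character ::
  "nat \<Rightarrow> (complex \<Rightarrow> 'f::field) \<Rightarrow> ('a, 'b) monoid_scheme \<Rightarrow> ('a \<Rightarrow> 'f mat) \<Rightarrow> 'a \<Rightarrow> complex"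
where
  "brauer_character p \<theta> G X =
     (\<lambda>g\<in>p_regular p G. \<Sum>x\<in>#proots (char_poly (X g)).
        inv_into (carrier (roots_of_unity_prime_to p)) \<theta> x)"

definition IBr ::
  "nat \<Rightarrow> (complex \<Rightarrow> 'f::field) \<Rightarrow> ('a, 'b) monoid_scheme \<Rightarrow> ('a \<Rightarrow> complex) set" where
  "IBr p \<theta> G = {brauer_character p \<theta> G X | n X. irreducible_representation G n X}"

text \<open>The description is definite because the kernel does not depend on the irreducible
  representation affording the Brauer character.\<close>

definition brauer_kernel ::
  "nat \<Rightarrow> (complex \<Rightarrow> 'f::field) \<Rightarrow> ('a, 'b) monoid_scheme \<Rightarrow> ('a \<Rightarrow> complex) \<Rightarrow> 'a set" where
  "brauer_kernel p \<theta> G \<phi> =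
     (THE N. \<exists>n X. irreducible_representation G n X \<and> brauer_character p \<theta> G X = \<phi> \<and>
        N = {g \<in> carrier G. X g = 1\<^sub>m n})"

definition brauer_L ::
  "nat \<Rightarrow> ('a, 'b) monoid_scheme \<Rightarrow> ('a \<Rightarrow> complex) \<Rightarrow> 'a set" where
  "brauer_L p G \<phi> = generate G {g \<in> p_regular p G. \<phi> g = \<phi> \<one>\<^bsub>G\<^esub>}"

definition brauer_K ::
  "nat \<Rightarrow> ('a, 'b) monoid_scheme \<Rightarrow> ('a \<Rightarrow> complex) \<Rightarrow> 'a set" where
  "brauer_K p G \<phi> =
     (THE K. subgroup K G \<and> brauer_L p G \<phi> \<subseteq> K \<and>
        carrier ((G\<lparr>carrier := K\<rparr>) Mod brauer_L p G \<phi>) = p_core p (G Mod brauer_L p G \<phi>))"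

end

(* Let X be an irreducible representation affording phi, with kernel N. A p-regular g
   satisfies phi(g) = phi(1) iff X(g) = 1: the n unit complex numbers summing to phi(g) must
   all be 1, so 1 is the only eigenvalue of X(g), and X(g) has order prime to p. Hence L(phi)
   is generated by the p-regular elements of N. It is normal in G, and N/L(phi) is a p-group
   because N has no p-regular elements outside L(phi). Conversely, if M/L(phi) is a normal
   p-subgroup of G/L(phi), then the space of vectors fixed by M is nonzero (orbit counting in
   characteristic p) and G-invariant, so it is everything and M is contained in N. Thus
   N = K(phi), and in particular N depends on phi only. *)
theory Submission
  imports
    Defs
    "HOL-Algebra.Group_Action"
    "HOL-Algebra.Sylow"
begin

hide_const (open) Polynomial.order Multiset.mult

subsection \<open>Matrices of finite order\<close>

lemma mat_eq_one_if_fixes_all_vecs: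
  fixes A :: "'a::comm_ring_1 mat"
  assumes A: "A \<in> carrier_mat n n"
    and fixed: "\<And>v. v \<in> carrier_vec n \<Longrightarrow> A *\<^sub>v v = v"
  shows "A = 1\<^sub>m n"
proof (rule eq_matI)
  fix i j assume ij: "i < dim_row (1\<^sub>m n :: 'a mat)" "j < dim_col (1\<^sub>m n :: 'a mat)"
  have "A $$ (i, j) = (A *\<^sub>v unit_vec n j) $ i"
    using A ij by simp
  also have "\<dots> = 1\<^sub>m n $$ (i, j)"
    using fixed[of "unit_vec n j"] ij by auto
  finally show "A $$ (i, j) = 1\<^sub>m n $$ (i, j)" .
qed (use A in auto)

lemma sum_powers_root_of_unity:
  fixes w :: "'a::field"
  assumes "w ^ m = 1" and "w \<noteq> 1"
  shows "(\<Sum>j<m. w ^ j) = 0"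
  using geometric_sum[of w m] assms by simp

text \<open>Split a vector \<open>v\<close> into its discrete Fourier components
  \<open>f j = \<Sum>i<m. w^(i*j) A^i v\<close>: each is zero or an
  eigenvector for \<open>w^(-j)\<close>, so only \<open>f 0 = m v\<close> survives.\<close>

lemma finite_order_mat_eq_one:
  fixes A :: "'a::field mat" and w :: 'a
  assumes A: "A \<in> carrier_mat n n" and pow: "A ^\<^sub>m m = 1\<^sub>m n"
    and w: "w ^ m = 1" "\<And>i. 0 < i \<Longrightarrow> i < m \<Longrightarrow> w ^ i \<noteq> 1"
    and m: "of_nat m \<noteq> (0 :: 'a)"
    and ev: "\<And>a. eigenvalue A a \<Longrightarrow> a = 1"
  shows "A = 1\<^sub>m n"
proof (rule mat_eq_one_if_fixes_all_vecs[OF A])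
  fix v :: "'a vec" assume v: "v \<in> carrier_vec n"
  define u where "u i = A ^\<^sub>m i *\<^sub>v v" for i
  have u_carrier: "u i \<in> carrier_vec n" for i
    unfolding u_def using A v by (meson mult_mat_vec_carrier pow_carrier_mat)
  have u_0: "u 0 = v" and u_m: "u m = v"
    using pow A v by (auto simp: u_def)
  \<comment> \<open>The recursion of matrix powers puts the new factor on the right. The left form
    needed here comes from the power law in the monoid of \<open>n\<close> by \<open>n\<close>
    matrices.\<close>
  have u_Suc: "u (Suc i) = A *\<^sub>v u i" for i
  proof -
    have "A ^\<^sub>m Suc i = A * A ^\<^sub>m i"
      using A by (simp add: pow_mat_ring_pow[OF A, of _ "()"] flip: pow_mat.simps)
        (metis A pow_mat.simps(2) pow_mat_ring_pow monoid.nat_pow_Suc2 ring_mat ring.is_monoid ring_mat_simps(1,5))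
    then show ?thesis
      unfolding u_def using A v by (simp add: assoc_mult_mat_vec[of A n n "A ^\<^sub>m i" n v] pow_carrier_mat)
  qed
  have "w \<noteq> 0" using w(1) m by (cases m) auto
  have "m > 0" using m by (cases m) auto
  define f where "f j = vec n (\<lambda>r. \<Sum>i<m. w ^ (i * j) * u i $ r)" for j
  have f_carrier: "f j \<in> carrier_vec n" for j by (simp add: f_def)
  \<comment> \<open>Multiplying by \<open>w ^ j\<close> and applying \<open>A\<close> shifts the
    summation index of \<open>f j\<close> by one. The sum does not change, since the terms for
    \<open>0\<close> and \<open>m\<close> agree: \<open>w ^ m = 1\<close> and
    \<open>u m = u 0\<close>.\<close>
  have "w ^ j \<cdot>\<^sub>v (A *\<^sub>v f j) = f j" for j
  proof (rule eq_vecI)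
    fix r assume "r < dim_vec (f j)"
    then have r: "r < n" by (simp add: f_def)
    have "(A *\<^sub>v f j) $ r = (\<Sum>c<n. A $$ (r, c) * (\<Sum>i<m. w ^ (i * j) * u i $ c))"
      using A r by (simp add: f_def scalar_prod_def lessThan_atLeast0)
    also have "\<dots> = (\<Sum>i<m. w ^ (i * j) * (\<Sum>c<n. A $$ (r, c) * u i $ c))"
      unfolding sum_distrib_left by (subst sum.swap) (simp add: mult_ac)
    also have "\<dots> = (\<Sum>i<m. w ^ (i * j) * u (Suc i) $ r)"
    proof (intro sum.cong refl)
      fix i
      show "w ^ (i * j) * (\<Sum>c<n. A $$ (r, c) * u i $ c) = w ^ (i * j) * u (Suc i) $ r"
        using A r u_carrier[of i] by (simp add: u_Suc scalar_prod_def lessThan_atLeast0)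
    qed
    finally have "w ^ j * (A *\<^sub>v f j) $ r = (\<Sum>i<m. w ^ (Suc i * j) * u (Suc i) $ r)"
      by (simp add: sum_distrib_left power_add mult_ac)
    also have "\<dots> = (\<Sum>i<m. w ^ (i * j) * u i $ r)"
    proof -
      have "w ^ (m * j) = 1" using w(1) by (simp add: power_mult)
      then have "w ^ (m * j) * u m $ r = w ^ (0 * j) * u 0 $ r"
        by (simp add: u_0 u_m)
      then show ?thesis
        using sum.lessThan_Suc_shift[of "\<lambda>i. w ^ (i * j) * u i $ r" m]
        by (simp add: sum.lessThan_Suc)
    qed
    finally show "(w ^ j \<cdot>\<^sub>v (A *\<^sub>v f j)) $ r = f j $ r"
      using A r by (simp add: f_def)
  qed (use A in \<open>simp add: f_def\<close>)
  note wAf = this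
  have Af: "A *\<^sub>v f j = inverse (w ^ j) \<cdot>\<^sub>v f j" for j
  proof -
    have "A *\<^sub>v f j = inverse (w ^ j) \<cdot>\<^sub>v (w ^ j \<cdot>\<^sub>v (A *\<^sub>v f j))"
      using \<open>w \<noteq> 0\<close> by (simp add: smult_smult_assoc)
    then show ?thesis by (simp only: wAf)
  qed
  have f_zero: "f j = 0\<^sub>v n" if "0 < j" "j < m" for j
  proof (rule ccontr)
    assume "f j \<noteq> 0\<^sub>v n"
    then have "eigenvalue A (inverse (w ^ j))"
      using A f_carrier Af unfolding eigenvalue_def eigenvector_def by auto
    then have "inverse (w ^ j) = 1" by (rule ev)
    then show False using w(2)[OF that] by simp
  qed
  have "f 0 = of_nat m \<cdot>\<^sub>v v"
  proof (rule eq_vecI)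
    fix r assume "r < dim_vec (of_nat m \<cdot>\<^sub>v v)"
    then have r: "r < n" using v by simp
    \<comment> \<open>Fourier inversion: the components \<open>f j\<close> with \<open>j\<close>
      nonzero vanish, so \<open>f 0\<close> is the sum of all of them. After exchanging the two
      sums, the inner one is a geometric sum over the powers of \<open>w ^ i\<close>, which is zero
      unless \<open>i = 0\<close>.\<close>
    have "f 0 $ r = (\<Sum>j<m. f j $ r)"
      using \<open>m > 0\<close> r f_zero by (subst sum.remove[of _ 0]) auto
    also have "\<dots> = (\<Sum>i<m. u i $ r * (\<Sum>j<m. (w ^ i) ^ j))"
      using r unfolding f_def sum_distrib_left
      by (simp add: mult_ac flip: power_mult) (subst sum.swap, simp add: mult_ac)
    also have "\<dots> = (\<Sum>i<m. if i = 0 then v $ r * of_nat m else 0)"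
    proof (intro sum.cong refl)
      fix i assume "i \<in> {..<m}"
      moreover have "(w ^ i) ^ m = 1"
        using w(1) by (metis power_mult mult.commute power_one)
      ultimately show "u i $ r * (\<Sum>j<m. (w ^ i) ^ j) = (if i = 0 then v $ r * of_nat m else 0)"
        using w(2)[of i] sum_powers_root_of_unity[of "w ^ i" m] by (auto simp: u_0)
    qed
    also have "\<dots> = v $ r * of_nat m" using \<open>m > 0\<close> by simp
    finally show "f 0 $ r = (of_nat m \<cdot>\<^sub>v v) $ r" using v r by simp
  qed (use v in \<open>simp add: f_def\<close>)
  then have "v = inverse (of_nat m) \<cdot>\<^sub>v f 0"
    using m by (simp add: smult_smult_assoc)
  moreover have "A *\<^sub>v f 0 = f 0" using Af[of 0] by simp
  ultimately show "A *\<^sub>v v = v"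
    using mult_mat_vec[OF A f_carrier] by metis
qed

section \<open>Sums of complex numbers of norm 1, and multisets of roots\<close>

lemma Re_sum_mset_le_size:
  fixes f :: "'a \<Rightarrow> complex"
  assumes "\<And>x. x \<in># M \<Longrightarrow> norm (f x) \<le> 1"
  shows "Re (\<Sum>x\<in>#M. f x) \<le> real (size M)"
  using assms
proof (induction M)
  case (add x M)
  then have "Re (f x) \<le> 1"
    using complex_Re_le_cmod[of "f x"] by force
  then show ?case using add by force
qed simp

text \<open>The equality case of the triangle inequality: the other terms contribute real part at
  most their number, which forces \<open>Re (f x)\<close> to be at least 1. A number of norm 1 with
  real part 1 is 1.\<close>

lemma sum_mset_unit_complex_eq_size:
  fixes f :: "'a \<Rightarrow> complex"
  assumes norm: "\<And>x. x \<in># M \<Longrightarrow> norm (f x) = 1"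
    and sum: "(\<Sum>x\<in>#M. f x) = of_nat (size M)" and x: "x \<in># M"
  shows "f x = 1"
proof -
  obtain B where B: "M = add_mset x B" using x by (metis multi_member_split)
  have "Re (\<Sum>x\<in>#B. f x) \<le> real (size B)"
    by (rule Re_sum_mset_le_size) (simp add: norm B)
  moreover have "Re (f x) + Re (\<Sum>x\<in>#B. f x) = real (size B) + 1"
    using arg_cong[OF sum, of Re] B by simp
  ultimately have "Re (f x) \<ge> 1" by simp
  then have "Re (f x) = 1" using complex_Re_le_cmod[of "f x"] norm[OF x] by simp
  then have "Im (f x) = 0"
    using norm[OF x] cmod_power2[of "f x"] by simp
  then show ?thesis using \<open>Re (f x) = 1\<close> by (simp add: complex_eq_iff)
qed

text \<open>Over an algebraically closed field \<open>f\<close> is a product of linear factors, and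
  \<open>proots\<close> returns exactly the multiset of these. It ensures that a Brauer character of
  degree \<open>n\<close> is a sum of \<open>n\<close> roots of unity.\<close>

lemma size_proots_alg_closed:
  fixes f :: "'a::alg_closed_field poly"
  assumes "f \<noteq> 0"
  shows "size (proots f) = degree f"
proof -
  obtain A where A: "size A = degree f" "f = smult (lead_coeff f) (\<Prod>x\<in>#A. [:-x, 1:])"
    using alg_closed_imp_factorization[OF assms] by blast
  have "proots (\<Prod>x\<in>#B. [:-x, 1:]) = B" for B :: "'a multiset"
  proof (induction B)
    case (add x B)
    have "(\<Prod>x\<in>#B. [:-x, 1:]) \<noteq> 0" by auto
    then have "proots ([:-x, 1:] * (\<Prod>x\<in>#B. [:-x, 1:])) = {#x#} + B"
      using add.IH by (subst proots_mult) (auto simp: proots_linear_factor[of "- x"])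
    then show ?case by simp
  qed simp
  then have "proots f = A"
    using assms by (subst A(2)) simp
  then show ?thesis using A(1) by simp
qed

subsection \<open>Actions of groups that are \<open>p\<close>-groups modulo a trivially acting subgroup\<close>

text \<open>Every stabilizer contains \<open>N\<close>, so every orbit length divides the index
  \<open>p ^ k\<close> of \<open>N\<close>. An orbit is therefore either a single fixed point or of
  length divisible by \<open>p\<close>. The group itself may have order divisible by other primes,
  as long as these come from \<open>N\<close>.\<close>

lemma (in group_action) card_fixed_points_cong:
  assumes E: "finite E" and p: "prime p"
    and N: "subgroup N G" "finite N"
    and trivial: "\<And>h x. h \<in> N \<Longrightarrow> x \<in> E \<Longrightarrow> \<phi> h x = x"
    and order: "order G = p ^ k * card N"
  shows "card E mod p = card {x \<in> E. \<forall>g\<in>carrier G. \<phi> g x = x} mod p"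
proof -
  interpret group G using group_hom group_hom.axioms(1) by blast
  define F where "F = {x \<in> E. \<forall>g\<in>carrier G. \<phi> g x = x}"
  \<comment> \<open>An infinite carrier would have \<open>order G = 0\<close>, so positivity of the
    given product yields finiteness.\<close>
  have finG: "finite (carrier G)"
  proof -
    have "card N > 0"
      using N subgroup.one_closed by (auto simp: card_gt_0_iff)
    then have "order G > 0" using order p prime_gt_0_nat by simp
    then show ?thesis using order_gt_0_iff_finite by blast
  qed
  have card_orbit: "\<exists>j. card (orbit G \<phi> x) = p ^ j" if x: "x \<in> E" for x
  proof -
    let ?S = "stabilizer G \<phi> x"
    have S: "subgroup ?S G" using stabilizer_subgroup[OF x] .
    interpret S: group "G\<lparr>carrier := ?S\<rparr>"
      using S by (rule subgroup_imp_group)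
    have "N \<subseteq> ?S"
      using trivial x subgroup.subset[OF N(1)] by (auto simp: stabilizer_def)
    then have "subgroup N (G\<lparr>carrier := ?S\<rparr>)"
      using subgroup_incl[OF N(1) S] by simp
    then have "card N dvd card ?S"
      using S.lagrange[of N] by (auto simp: Coset.order_def dest: sym)
    then obtain s where "card ?S = card N * s" by blast
    moreover have "card N > 0"
      using N subgroup.one_closed by (auto simp: card_gt_0_iff)
    ultimately have "card (orbit G \<phi> x) * s = p ^ k"
      using orbit_stabilizer_theorem[OF x] order by (simp add: mult_ac)
    then show ?thesis
      using p by (metis divides_primepow_nat dvd_triv_left)
  qed
  have orbit_fixed: "orbit G \<phi> x = {x}" if "x \<in> F" for x
    using that one_closed unfolding orbit_def F_def by force
  have orbit_moved: "p dvd card (orbit G \<phi> x)" if x: "x \<in> E - F" for x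
  proof -
    obtain j where j: "card (orbit G \<phi> x) = p ^ j" using card_orbit x by blast
    have "j \<noteq> 0"
    proof
      assume "j = 0"
      then have "card (orbit G \<phi> x) = 1" using j by simp
      then obtain y where y: "orbit G \<phi> x = {y}" by (rule card_1_singletonE)
      then have "y = x" using orbit_refl[of x] x by auto
      then have "x \<in> F" using y x by (auto simp: orbit_def F_def)
      then show False using x by blast
    qed
    then show ?thesis using j by simp
  qed
  have finite_orbit: "finite (orbit G \<phi> x)" for x
    using finG by (simp add: orbit_def Setcompr_eq_image)
  have fin_orbits: "finite (orbits G E \<phi>)"
    using E by (simp add: orbits_def Setcompr_eq_image)
  \<comment> \<open>Both \<open>E\<close> and its fixed points \<open>F\<close> are counted orbit by
    orbit, \<open>F\<close> through its indicator function, so that the congruence can be checked on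
    each orbit separately.\<close>
  have EF: "card E = (\<Sum>orb\<in>orbits G E \<phi>. card orb)" "card F = (\<Sum>orb\<in>orbits G E \<phi>. card (orb \<inter> F))"
  proof -
    show "card E = (\<Sum>orb\<in>orbits G E \<phi>. card orb)"
      unfolding card_eq_sum by (rule disjoint_sum[OF E, symmetric])
    have "(\<Sum>orb\<in>orbits G E \<phi>. card (orb \<inter> F)) = (\<Sum>orb\<in>orbits G E \<phi>. \<Sum>x\<in>orb. if x \<in> F then 1 else 0)"
      using finite_orbit by (intro sum.cong refl) (auto simp: orbits_def sum.If_cases)
    also have "\<dots> = card F"
      using E by (subst disjoint_sum[OF E]) (auto simp: sum.If_cases F_def intro: arg_cong[where f=card])
    finally show "card F = (\<Sum>orb\<in>orbits G E \<phi>. card (orb \<inter> F))" by simp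
  qed
  have "card orb mod p = card (orb \<inter> F) mod p" if orb: "orb \<in> orbits G E \<phi>" for orb
  proof -
    obtain x where x: "x \<in> E" "orb = orbit G \<phi> x" using orb by (auto simp: orbits_def)
    show ?thesis
    proof (cases "x \<in> F")
      case True
      then show ?thesis using orbit_fixed x by simp
    next
      case False
      \<comment> \<open>An orbit that meets \<open>F\<close> consists of that fixed point alone, so
        the orbit of a moved point misses \<open>F\<close> entirely.\<close>
      have "orb \<inter> F = {}"
      proof (rule ccontr)
        assume "orb \<inter> F \<noteq> {}"
        then obtain y where y: "y \<in> orb" "y \<in> F" by blast
        then have "x \<in> orbit G \<phi> y"
          using orbit_sym x by (auto simp: F_def)
        then show False using orbit_fixed[OF y(2)] y(2) False by simp
      qed
      then show ?thesis using orbit_moved x False by simp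
    qed
  qed
  then show ?thesis
    unfolding F_def[symmetric] EF
    by (subst (1 2) mod_sum_eq[symmetric]) (simp cong: sum.cong)
qed

text \<open>For a prime \<open>q \<noteq> p\<close>, a Sylow \<open>q\<close>-subgroup consists of \<open>p\<close>-regular elements and
  hence lies in \<open>L\<close>.\<close>

lemma (in group) p_index_if_p_regular_subset:
  assumes fin: "finite (carrier G)" and p: "prime p"
    and L: "subgroup L G"
    and reg: "\<And>g. g \<in> carrier G \<Longrightarrow> \<not> p dvd ord g \<Longrightarrow> g \<in> L"
  shows "\<exists>k. order G = p ^ k * card L"
proof -
  define r where "r = card (rcosets L)"
  have r: "r * card L = order G" unfolding r_def using lagrange[OF L] .
  have "order G > 0" using fin order_gt_0_iff_finite by blast
  then have "r > 0" using r by (metis gr0I mult_0 less_irrefl)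
  have "q = p" if q: "prime q" "q dvd r" for q
  proof (rule ccontr)
    assume "q \<noteq> p"
    define b where "b = multiplicity q (order G)"
    obtain m where m: "order G = q ^ b * m"
      using multiplicity_dvd[of q "order G"] unfolding b_def by blast
    obtain Q where Q: "subgroup Q G" "card Q = q ^ b"
      using sylow_thm[OF q(1) is_group m fin] by blast
    have "Q \<subseteq> L"
    proof
      fix g assume g: "g \<in> Q"
      then have gG: "g \<in> carrier G" using subgroup.subset[OF Q(1)] by blast
      interpret Q: group "G\<lparr>carrier := Q\<rparr>" using Q(1) by (rule subgroup_imp_group)
      have "g [^]\<^bsub>G\<lparr>carrier := Q\<rparr>\<^esub> order (G\<lparr>carrier := Q\<rparr>) = \<one>\<^bsub>G\<lparr>carrier := Q\<rparr>\<^esub>"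
        using Q.pow_order_eq_1[of g] g by simp
      then have "g [^] (q ^ b) = \<one>"
        using Q(2) by (simp add: Coset.order_def nat_pow_consistent[symmetric])
      then have "ord g dvd q ^ b" using pow_eq_id[OF gG] by blast
      then have "\<not> p dvd ord g"
        using q(1) p \<open>q \<noteq> p\<close> prime_dvd_power[of p q b] primes_dvd_imp_eq[of p q]
        by (auto dest: dvd_trans)
      then show "g \<in> L" using reg gG by blast
    qed
    then have "subgroup Q (G\<lparr>carrier := L\<rparr>)" using subgroup_incl[OF Q(1) L] by simp
    then have "q ^ b dvd card L"
      using group.lagrange[OF subgroup_imp_group[OF L], of Q] Q(2)
      by (auto simp: Coset.order_def dest: sym)
    \<comment> \<open>The full \<open>q\<close>-part \<open>q ^ b\<close> divides
      \<open>card L\<close> and a further \<open>q\<close> divides the index, one factor more than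
      the order of \<open>G\<close> admits.\<close>
    then have "q ^ Suc b dvd order G"
      using q(2) unfolding r[symmetric] power_Suc by (rule mult_dvd_mono[rotated])
    then show False
      using multiplicity_geI[of "order G" q "Suc b"] \<open>order G > 0\<close> q(1)
      unfolding b_def by (metis Suc_n_not_le_n less_irrefl not_prime_unit)
  qed
  \<comment> \<open>A prime divisor of the part \<open>m\<close> prime to \<open>p\<close> would
    divide \<open>r\<close> and hence be \<open>p\<close> itself, so there is none.\<close>
  moreover obtain m where m: "r = p ^ multiplicity p r * m" "\<not> p dvd m"
    using multiplicity_decompose'[of r p] \<open>r > 0\<close> p not_prime_unit[of p] by blast
  ultimately have "m = 1"
    using prime_factor_nat[of m] dvd_mult[of _ m "p ^ multiplicity p r"] by force
  then show ?thesis using r m(1) by (metis mult.right_neutral)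
qed

subsection \<open>Representations and fixed vectors\<close>

lemma representation_carrier:
  fixes X :: "'a \<Rightarrow> 'f::field mat"
  assumes "representation G n X" and "g \<in> carrier G"
  shows "X g \<in> carrier_mat n n"
  using assms by (auto simp: representation_def hom_def units_of_def Units_def ring_mat_simps)

lemma representation_mult:
  fixes X :: "'a \<Rightarrow> 'f::field mat"
  assumes "representation G n X" and "g \<in> carrier G" and "h \<in> carrier G"
  shows "X (g \<otimes>\<^bsub>G\<^esub> h) = X g * X h"
  using assms by (auto simp: representation_def hom_def units_of_def ring_mat_simps)

lemma representation_group_hom:
  fixes X :: "'a \<Rightarrow> 'f::field mat"
  assumes "group G" and "representation G n X"
  shows "group_hom G (units_of (ring_mat TYPE('f) n ())) X"
  using assms monoid.units_group[OF ring.is_monoid[OF ring_mat]]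
  by (auto simp: representation_def intro!: group_hom.intro group_hom_axioms.intro)

lemma representation_one:
  fixes X :: "'a \<Rightarrow> 'f::field mat"
  assumes "group G" and "representation G n X"
  shows "X \<one>\<^bsub>G\<^esub> = 1\<^sub>m n"
  using group_hom.hom_one[OF representation_group_hom[OF assms]]
  by (simp add: units_of_def ring_mat_simps)

lemma representation_pow:
  fixes X :: "'a \<Rightarrow> 'f::field mat"
  assumes "group G" and "representation G n X" and g: "g \<in> carrier G"
  shows "X (g [^]\<^bsub>G\<^esub> (k::nat)) = X g ^\<^sub>m k"
proof (induction k)
  case 0
  show ?case
    using representation_one[OF assms(1,2)] representation_carrier[OF assms(2) g]
    by (simp add: group.is_monoid[OF assms(1)] monoid.nat_pow_0)
next
  case (Suc k)
  then show ?case
    using representation_mult[OF assms(2) monoid.nat_pow_closed[OF group.is_monoid[OF assms(1)] g, of k] g]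
    by (simp add: monoid.nat_pow_Suc[OF group.is_monoid[OF assms(1)]])
qed

lemma mult_mat_vec_zero:
  fixes A :: "'a::semiring_0 mat"
  assumes "A \<in> carrier_mat m n"
  shows "A *\<^sub>v 0\<^sub>v n = 0\<^sub>v m"
  using assms by (intro eq_vecI) (auto simp: scalar_prod_def)

lemma representation_mult_vec:
  fixes X :: "'a \<Rightarrow> 'f::field mat"
  assumes X: "representation G n X" and "g \<in> carrier G" and "h \<in> carrier G"
    and "v \<in> carrier_vec n"
  shows "X g *\<^sub>v (X h *\<^sub>v v) = X (g \<otimes>\<^bsub>G\<^esub> h) *\<^sub>v v"
  using assms representation_carrier[OF X] representation_mult[OF X]
  by (simp add: assoc_mult_mat_vec[of _ n n _ n])

lemma representation_inv_vec:
  fixes X :: "'a \<Rightarrow> 'f::field mat"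
  assumes G: "group G" and X: "representation G n X" and g: "g \<in> carrier G"
    and v: "v \<in> carrier_vec n"
  shows "X (inv\<^bsub>G\<^esub> g) *\<^sub>v (X g *\<^sub>v v) = v" and "X g *\<^sub>v (X (inv\<^bsub>G\<^esub> g) *\<^sub>v v) = v"
  using assms representation_mult_vec[OF X _ _ v] representation_one[OF G X]
  by (simp_all add: group.l_inv group.r_inv)

lemma representation_kernel_normal:
  fixes X :: "'a \<Rightarrow> 'f::field mat"
  assumes "group G" and "representation G n X"
  shows "{g \<in> carrier G. X g = 1\<^sub>m n} \<lhd> G"
proof -
  have "{g \<in> carrier G. X g = 1\<^sub>m n} = kernel G (units_of (ring_mat TYPE('f) n ())) X"
    by (auto simp: kernel_def units_of_def ring_mat_simps)
  then show ?thesis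
    using group_hom.normal_kernel[OF representation_group_hom[OF assms]] by simp
qed

section \<open>The prime field and finite additive groups of vectors\<close>

lemma finite_range_of_nat_CHAR:
  assumes "CHAR('f::ring_1) > 0"
  shows "finite (range (of_nat :: nat \<Rightarrow> 'f))"
proof -
  let ?p = "CHAR('f)"
  have "(of_nat k :: 'f) = of_nat (k mod ?p)" for k
  proof -
    have "(of_nat k :: 'f) = of_nat (?p * (k div ?p) + k mod ?p)" by simp
    also have "\<dots> = of_nat (k mod ?p)" by (simp only: of_nat_add of_nat_mult of_nat_CHAR) simp
    finally show ?thesis .
  qed
  then have "range (of_nat :: nat \<Rightarrow> 'f) \<subseteq> of_nat ` {..<?p}"
    using assms by (metis (no_types, lifting) image_iff image_subsetI lessThan_iff mod_less_divisor)
  then show ?thesis using finite_surj by blast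
qed

text \<open>In characteristic \<open>p\<close> the negative of \<open>k\<close> is
  \<open>(p - 1) * k\<close>. Thus the multiples of 1 by natural numbers already form an additive
  group and can serve as coefficients.\<close>

lemma uminus_range_of_nat_CHAR:
  assumes "CHAR('f::ring_1) > 0" and "c \<in> range (of_nat :: nat \<Rightarrow> 'f)"
  shows "- c \<in> range (of_nat :: nat \<Rightarrow> 'f)"
proof -
  obtain k where k: "c = of_nat k" using assms(2) by blast
  have "(of_nat (CHAR('f) * k) :: 'f) = 0" by (simp only: of_nat_mult of_nat_CHAR mult_zero_left)
  moreover have "CHAR('f) * k = (CHAR('f) - 1) * k + k"
    using assms(1) by (simp add: algebra_simps)
  ultimately have "of_nat ((CHAR('f) - 1) * k) + c = 0"
    unfolding k by (metis of_nat_add)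
  then have "- c = of_nat ((CHAR('f) - 1) * k)"
    by (metis minus_unique add.commute)
  then show ?thesis by blast
qed

text \<open>\<open>W\<close> is a finite additive group in which the nonzero vector \<open>v\<close>
  has order \<open>CHAR('f)\<close>, and the order of an element divides the order of the
  group.\<close>

lemma CHAR_dvd_card_closed_vec_set:
  fixes W :: "'f::field vec set"
  assumes p: "prime CHAR('f)" and W: "finite W" "W \<subseteq> carrier_vec n"
    and closed: "0\<^sub>v n \<in> W" "\<And>v w. v \<in> W \<Longrightarrow> w \<in> W \<Longrightarrow> v + w \<in> W" "\<And>w. w \<in> W \<Longrightarrow> - w \<in> W"
    and v: "v \<in> W" "v \<noteq> 0\<^sub>v n"
  shows "CHAR('f) dvd card W"
proof -
  let ?p = "CHAR('f)"
  \<comment> \<open>Addition is written as the multiplication of a monoid record so that element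
    orders become available. The power \<open>k\<close> of \<open>v\<close> in \<open>H\<close> is
    then the scalar multiple by \<open>of_nat k\<close>.\<close>
  define H :: "'f vec monoid" where "H = \<lparr>carrier = W, mult = (+), one = 0\<^sub>v n\<rparr>"
  have "group H"
  proof (rule groupI)
    fix x assume "x \<in> carrier H"
    then have "- x + x = 0\<^sub>v n" "- x \<in> W"
      using W(2) closed(3) by (auto simp: H_def intro!: uminus_l_inv_vec)
    then show "\<exists>y\<in>carrier H. y \<otimes>\<^bsub>H\<^esub> x = \<one>\<^bsub>H\<^esub>" by (auto simp: H_def)
  qed (use W(2) closed in \<open>auto simp: H_def intro!: assoc_add_vec left_zero_vec\<close>)
  then interpret H: group H .
  have vc: "v \<in> carrier_vec n" using v(1) W(2) by blast
  have pow: "v [^]\<^bsub>H\<^esub> k = of_nat k \<cdot>\<^sub>v v" for k :: nat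
  proof (induction k)
    case 0
    show ?case using vc by (auto simp: H_def)
  next
    case (Suc k)
    then show ?case
      using vc by (auto simp: H_def distrib_right intro!: eq_vecI)
  qed
  have "v [^]\<^bsub>H\<^esub> ?p = \<one>\<^bsub>H\<^esub>"
    using vc by (subst pow) (auto simp: H_def)
  moreover have vH: "v \<in> carrier H" using v by (simp add: H_def)
  ultimately have "H.ord v dvd ?p" using H.pow_eq_id by blast
  moreover have "H.ord v \<noteq> 1"
    using H.ord_eq_1[OF vH] v by (simp add: H_def)
  ultimately have "H.ord v = ?p" using p by (metis prime_nat_iff)
  then show ?thesis
    using H.ord_dvd_group_order[OF vH] by (simp add: H_def Coset.order_def)
qed

text \<open>The field is infinite, so the fixed points are counted in the span of an orbit over the
  prime field (the range of \<^const>\<open>of_nat\<close>).\<close>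

lemma (in group) fixed_vector_exists:
  fixes X :: "'a \<Rightarrow> 'f::field mat"
  assumes fin: "finite (carrier G)" and p: "prime CHAR('f)" and n: "n > 0"
    and X: "representation G n X"
    and N: "subgroup N G" and trivial: "\<And>h. h \<in> N \<Longrightarrow> X h = 1\<^sub>m n"
    and order: "order G = CHAR('f) ^ k * card N"
  shows "\<exists>w\<in>carrier_vec n. w \<noteq> 0\<^sub>v n \<and> (\<forall>g\<in>carrier G. X g *\<^sub>v w = w)"
proof -
  let ?p = "CHAR('f)" and ?D = "range (of_nat :: nat \<Rightarrow> 'f)"
  note Xc [simp] = representation_carrier[OF X]
  \<comment> \<open>The first unit vector exists because \<open>n > 0\<close>. Only its being
    nonzero matters for the span of its orbit.\<close>
  define v where "v = (unit_vec n 0 :: 'f vec)"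
  have v: "v \<in> carrier_vec n" "v \<noteq> 0\<^sub>v n"
    using n by (auto simp: v_def unit_vec_def vec_eq_iff)
  define comb where "comb c = vec n (\<lambda>i. \<Sum>g\<in>carrier G. c g * (X g *\<^sub>v v) $ i)" for c
  define W where "W = comb ` (carrier G \<rightarrow> ?D)"
  have comb_carrier [simp]: "comb c \<in> carrier_vec n" for c by (simp add: comb_def)
  have comb_restrict: "comb (restrict c (carrier G)) = comb c" for c
    by (simp add: comb_def cong: sum.cong)
  \<comment> \<open>Coefficients outside the carrier do not affect \<open>comb\<close>, so
    extensional functions suffice, and there are only finitely many of those with values in the
    finite set \<open>?D\<close>.\<close>
  have "W \<subseteq> comb ` (carrier G \<rightarrow>\<^sub>E ?D)"
  proof
    fix w assume "w \<in> W"
    then obtain c where "w = comb c" "c \<in> carrier G \<rightarrow> ?D" by (auto simp: W_def)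
    then have "w = comb (restrict c (carrier G))" "restrict c (carrier G) \<in> carrier G \<rightarrow>\<^sub>E ?D"
      using comb_restrict by auto
    then show "w \<in> comb ` (carrier G \<rightarrow>\<^sub>E ?D)" by blast
  qed
  then have finW: "finite W"
    using finite_range_of_nat_CHAR[where ?'f='f] p fin
    by (meson finite_PiE finite_imageI finite_subset prime_gt_0_nat)
  have Wc: "W \<subseteq> carrier_vec n" by (auto simp: W_def)
  have zero: "0\<^sub>v n \<in> W"
  proof -
    have "0\<^sub>v n = comb (\<lambda>_. of_nat 0)" by (auto simp: comb_def)
    then show ?thesis unfolding W_def by blast
  qed
  have add: "a + b \<in> W" if "a \<in> W" "b \<in> W" for a b
  proof -
    obtain c d where cd: "a = comb c" "b = comb d" "c \<in> carrier G \<rightarrow> ?D" "d \<in> carrier G \<rightarrow> ?D"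
      using \<open>a \<in> W\<close> \<open>b \<in> W\<close> by (auto simp: W_def)
    have "a + b = comb (\<lambda>g. c g + d g)"
      unfolding cd by (auto simp: comb_def distrib_right sum.distrib)
    moreover have "c g + d g \<in> ?D" if "g \<in> carrier G" for g
    proof -
      obtain i j where "c g = of_nat i" "d g = of_nat j" using cd \<open>g \<in> carrier G\<close> by blast
      then show ?thesis by (metis of_nat_add rangeI)
    qed
    ultimately show ?thesis unfolding W_def by blast
  qed
  have uminus: "- a \<in> W" if "a \<in> W" for a
  proof -
    obtain c where c: "a = comb c" "c \<in> carrier G \<rightarrow> ?D"
      using \<open>a \<in> W\<close> by (auto simp: W_def)
    have "- a = comb (\<lambda>g. - c g)"
      unfolding c by (auto simp: comb_def sum_negf)
    moreover have "- c g \<in> ?D" if "g \<in> carrier G" for g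
      using c(2) that p by (intro uminus_range_of_nat_CHAR) (auto simp: prime_gt_0_nat)
    ultimately show ?thesis unfolding W_def by blast
  qed
  have "v \<in> W"
  proof -
    \<comment> \<open>The coefficient function is 1 at the identity and 0 elsewhere, written under
      \<open>of_nat\<close> so that its values visibly lie in \<open>?D\<close>.\<close>
    have "v = comb (\<lambda>g. of_nat (if g = \<one> then 1 else 0))"
      using fin v representation_one[OF is_group X]
      by (auto simp: comb_def if_distrib[of "\<lambda>x. x * _"] if_distrib[of of_nat] cong: if_cong)
    then show ?thesis unfolding W_def by blast
  qed
  have dvd: "?p dvd card W"
    using CHAR_dvd_card_closed_vec_set[OF p finW Wc zero add uminus \<open>v \<in> W\<close> v(2)] .
  have act: "X h *\<^sub>v a \<in> W" if h: "h \<in> carrier G" and "a \<in> W" for h a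
  proof -
    obtain c where c: "a = comb c" "c \<in> carrier G \<rightarrow> ?D"
      using \<open>a \<in> W\<close> by (auto simp: W_def)
    \<comment> \<open>Left translation by \<open>h\<close> permutes the orbit, so on coefficients
      \<open>X h\<close> acts by precomposition with left multiplication by
      \<open>inv h\<close>.\<close>
    have "X h *\<^sub>v a = comb (\<lambda>g. c (inv h \<otimes> g))"
    proof (rule eq_vecI)
      fix i assume "i < dim_vec (comb (\<lambda>g. c (inv h \<otimes> g)))"
      then have i: "i < n" by (simp add: comb_def)
      have "(X h *\<^sub>v a) $ i = (\<Sum>j<n. X h $$ (i, j) * (\<Sum>g\<in>carrier G. c g * (X g *\<^sub>v v) $ j))"
        using i Xc[OF h] unfolding c by (simp add: comb_def scalar_prod_def lessThan_atLeast0)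
      also have "\<dots> = (\<Sum>g\<in>carrier G. c g * (\<Sum>j<n. X h $$ (i, j) * (X g *\<^sub>v v) $ j))"
        unfolding sum_distrib_left by (subst sum.swap) (simp add: mult_ac)
      also have "\<dots> = (\<Sum>g\<in>carrier G. c g * (X (h \<otimes> g) *\<^sub>v v) $ i)"
      proof (intro sum.cong refl)
        fix g assume g: "g \<in> carrier G"
        have "(X (h \<otimes> g) *\<^sub>v v) $ i = (X h *\<^sub>v (X g *\<^sub>v v)) $ i"
          using representation_mult_vec[OF X h g v(1)] by simp
        also have "\<dots> = (\<Sum>j<n. X h $$ (i, j) * (X g *\<^sub>v v) $ j)"
          using i Xc[OF h] Xc[OF g] by (simp add: scalar_prod_def lessThan_atLeast0)
        finally show "c g * (\<Sum>j<n. X h $$ (i, j) * (X g *\<^sub>v v) $ j) = c g * (X (h \<otimes> g) *\<^sub>v v) $ i"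
          by simp
      qed
      also have "\<dots> = (\<Sum>g\<in>carrier G. c (inv h \<otimes> g) * (X g *\<^sub>v v) $ i)"
        by (rule sum.reindex_bij_witness[of _ "\<lambda>g. inv h \<otimes> g" "\<lambda>g. h \<otimes> g"])
          (use h in \<open>auto simp flip: m_assoc\<close>)
      finally show "(X h *\<^sub>v a) $ i = comb (\<lambda>g. c (inv h \<otimes> g)) $ i"
        using i by (simp add: comb_def)
    qed (use Xc[OF h] in \<open>simp add: comb_def\<close>)
    moreover have "(\<lambda>g. c (inv h \<otimes> g)) \<in> carrier G \<rightarrow> ?D"
      using c(2) h by auto
    ultimately show ?thesis unfolding W_def by blast
  qed
  \<comment> \<open>The restriction to \<open>W\<close> makes each map extensional, as membership in
    \<open>Bij W\<close> demands.\<close>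
  define \<phi> where "\<phi> g = (\<lambda>w\<in>W. X g *\<^sub>v w)" for g
  have bij: "\<phi> g \<in> Bij W" if g: "g \<in> carrier G" for g
  proof -
    have "bij_betw (\<phi> g) W W"
      by (rule bij_betw_byWitness[where f' = "\<lambda>w. X (inv g) *\<^sub>v w"])
        (use g Wc act representation_inv_vec[OF is_group X g] in \<open>auto simp: \<phi>_def\<close>)
    then show ?thesis by (simp add: Bij_def \<phi>_def)
  qed
  have "\<phi> \<in> hom G (BijGroup W)"
  proof (rule homI)
    fix g h assume gh: "g \<in> carrier G" "h \<in> carrier G"
    then have "\<phi> (g \<otimes> h) = compose W (\<phi> g) (\<phi> h)"
      using act Wc representation_mult_vec[OF X gh] by (auto simp: \<phi>_def compose_def fun_eq_iff)
    then show "\<phi> (g \<otimes> h) = \<phi> g \<otimes>\<^bsub>BijGroup W\<^esub> \<phi> h"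
      using bij gh by (simp add: BijGroup_def)
  qed (use bij in \<open>simp add: BijGroup_def\<close>)
  then interpret action: group_action G W \<phi>
    by (intro group_action.intro group_hom.intro group_hom_axioms.intro is_group group_BijGroup)
  let ?F = "{w \<in> W. \<forall>g\<in>carrier G. \<phi> g w = w}"
  have "card W mod ?p = card ?F mod ?p"
  proof (rule action.card_fixed_points_cong[OF finW p N _ _ order])
    show "finite N" using N fin by (meson finite_subset subgroup.subset)
    show "\<phi> h w = w" if "h \<in> N" "w \<in> W" for h w
      using that trivial Wc by (auto simp: \<phi>_def)
  qed
  then have "?p dvd card ?F" using dvd by (simp add: mod_eq_0_iff_dvd[symmetric])
  moreover have "0\<^sub>v n \<in> ?F"
    using zero mult_mat_vec_zero[OF Xc] by (auto simp: \<phi>_def)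
  moreover have "finite ?F" using finW by simp
  ultimately have "card ?F \<ge> ?p"
    by (intro dvd_imp_le) (auto simp: card_gt_0_iff)
  \<comment> \<open>The number of fixed vectors is a multiple of the characteristic and is positive
    because of the zero vector. Hence there is a second fixed vector.\<close>
  then have "card ?F > 1" using prime_gt_1_nat[OF p] by linarith
  then have "\<not> ?F \<subseteq> {0\<^sub>v n}"
    using card_mono[of "{0\<^sub>v n}" ?F] by auto
  then obtain w where "w \<in> ?F" "w \<noteq> 0\<^sub>v n" by blast
  then show ?thesis using Wc by (auto simp: \<phi>_def)
qed

text \<open>The vectors fixed by \<open>M\<close> form a subspace, invariant under \<open>G\<close>
  because \<open>M\<close> is normal, and nonzero because \<open>M\<close> acts through a quotient
  of \<open>p\<close>-power order in characteristic \<open>p\<close>. Irreducibility leaves only the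
  whole space.\<close>

lemma (in group) irreducible_trivial_on_normal_p_extension:
  fixes X :: "'a \<Rightarrow> 'f::field mat"
  assumes fin: "finite (carrier G)" and p: "prime CHAR('f)"
    and irr: "irreducible_representation G n X"
    and M: "M \<lhd> G" and L: "subgroup L G" "L \<subseteq> M"
    and trivial: "\<And>h. h \<in> L \<Longrightarrow> X h = 1\<^sub>m n"
    and card: "card M = CHAR('f) ^ k * card L"
    and m: "m \<in> M"
  shows "X m = 1\<^sub>m n"
proof -
  have X: "representation G n X" and n: "n > 0"
    and no_sub: "\<And>W. VectorSpace.subspace (class_ring :: 'f ring) W (module_vec TYPE('f) n) \<Longrightarrow>
        (\<And>g w. g \<in> carrier G \<Longrightarrow> w \<in> W \<Longrightarrow> X g *\<^sub>v w \<in> W) \<Longrightarrow>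
        W = {0\<^sub>v n} \<or> W = carrier_vec n"
    using irr unfolding irreducible_representation_def by blast+
  interpret M: normal M G by (rule M)
  have MG: "x \<in> carrier G" if "x \<in> M" for x using M.subset that by blast
  note Xc = representation_carrier[OF X]
  define W where "W = {w \<in> carrier_vec n. \<forall>x\<in>M. X x *\<^sub>v w = w}"
  have "VectorSpace.subspace (class_ring :: 'f ring) W (module_vec TYPE('f) n)"
    unfolding VectorSpace.subspace_def submodule_def
    using vec_vs[of n, where ?'a='f] vec_module[of n, where ?'a='f] MG Xc
    by (auto simp: W_def module_vec_simps mult_mat_vec_zero
        mult_add_distrib_mat_vec[of _ n n] mult_mat_vec[of _ n n])
  moreover have "X g *\<^sub>v w \<in> W" if g: "g \<in> carrier G" and w: "w \<in> W" for g w
  proof -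
    have wc: "w \<in> carrier_vec n" and fixed: "\<And>x. x \<in> M \<Longrightarrow> X x *\<^sub>v w = w"
      using w by (auto simp: W_def)
    have "X x *\<^sub>v (X g *\<^sub>v w) = X g *\<^sub>v w" if x: "x \<in> M" for x
    proof -
      have xG: "x \<in> carrier G" using MG x .
      \<comment> \<open>Normality lets \<open>x\<close> pass \<open>g\<close>: the product of
        \<open>x\<close> and \<open>g\<close> equals that of \<open>g\<close> and the conjugate of
        \<open>x\<close> by \<open>inv g\<close>, which fixes \<open>w\<close>.\<close>
      have "inv g \<otimes> x \<otimes> g \<in> M" using M.inv_op_closed1[OF g x] .
      then have "X g *\<^sub>v w = X g *\<^sub>v (X (inv g \<otimes> x \<otimes> g) *\<^sub>v w)"
        by (simp add: fixed)
      also have "\<dots> = X (g \<otimes> (inv g \<otimes> x \<otimes> g)) *\<^sub>v w"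
        using g xG wc by (intro representation_mult_vec[OF X]) auto
      also have "g \<otimes> (inv g \<otimes> x \<otimes> g) = x \<otimes> g"
        using g xG by (simp add: m_assoc[symmetric])
      also have "X (x \<otimes> g) *\<^sub>v w = X x *\<^sub>v (X g *\<^sub>v w)"
        using representation_mult_vec[OF X xG g wc] by simp
      finally show ?thesis by simp
    qed
    moreover have "X g *\<^sub>v w \<in> carrier_vec n"
      using mult_mat_vec_carrier[OF Xc[OF g] wc] .
    ultimately show ?thesis by (simp add: W_def)
  qed
  moreover have "W \<noteq> {0\<^sub>v n}"
  proof -
    \<comment> \<open>\<open>M\<close> is treated as a group of its own, since the index that is a
      power of the characteristic is that of \<open>L\<close> in \<open>M\<close>, not in
      \<open>G\<close>.\<close>
    interpret H: group "G\<lparr>carrier := M\<rparr>" using subgroup_imp_group[OF M.subgroup_axioms] .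
    have "representation (G\<lparr>carrier := M\<rparr>) n X"
      using X MG unfolding representation_def by (auto simp: hom_def)
    moreover have "subgroup L (G\<lparr>carrier := M\<rparr>)"
      using subgroup_incl[OF L(1) M.subgroup_axioms L(2)] .
    moreover have "finite M" using fin M.subset finite_subset by blast
    ultimately obtain w where "w \<in> carrier_vec n" "w \<noteq> 0\<^sub>v n" "\<forall>g\<in>M. X g *\<^sub>v w = w"
      using H.fixed_vector_exists[of n X L k] p n trivial card
      by (auto simp: Coset.order_def)
    then show ?thesis by (auto simp: W_def)
  qed
  ultimately have "W = carrier_vec n" using no_sub by blast
  then show ?thesis
    using mat_eq_one_if_fixes_all_vecs[OF Xc[OF MG[OF m]]] m by (auto simp: W_def)
qed

subsection \<open>Brauer characters at \<open>p\<close>-regular elements\<close>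

lemma Units_class_ring: "Units (class_ring :: 'f::field ring) = - {0}"
proof -
  have "\<exists>y. y * x = 1 \<and> x * y = 1" if "x \<noteq> 0" for x :: 'f
    using that by (intro exI[of _ "inverse x"]) simp
  then show ?thesis by (auto simp: Units_def)
qed

lemma root_correspondenceD:
  fixes \<theta> :: "complex \<Rightarrow> 'f::field"
  assumes \<theta>: "root_correspondence p \<theta>"
  shows "inj_on \<theta> (carrier (roots_of_unity_prime_to p))"
    and "\<theta> ` carrier (roots_of_unity_prime_to p) = - {0}"
    and "a \<in> carrier (roots_of_unity_prime_to p) \<Longrightarrow> b \<in> carrier (roots_of_unity_prime_to p) \<Longrightarrow>
      \<theta> (a * b) = \<theta> a * \<theta> b"
    and "1 \<in> carrier (roots_of_unity_prime_to p)"
    and "\<theta> 1 = 1"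
proof -
  let ?C = "carrier (roots_of_unity_prime_to p)"
  show "inj_on \<theta> ?C" and img: "\<theta> ` ?C = - {0}"
    using \<theta> by (simp_all add: root_correspondence_def iso_def bij_betw_def units_of_def Units_class_ring)
  show mult: "\<theta> (a * b) = \<theta> a * \<theta> b" if "a \<in> ?C" "b \<in> ?C" for a b
    using \<theta> that by (simp add: root_correspondence_def iso_def hom_def units_of_def roots_of_unity_prime_to_def)
  show one: "1 \<in> ?C"
    by (auto simp: roots_of_unity_prime_to_def intro!: exI[of _ 1])
  \<comment> \<open>The value \<open>\<theta> 1\<close> is its own square and nonzero, hence
    1.\<close>
  have "\<theta> 1 \<noteq> 0" using img one by blast
  then show "\<theta> 1 = 1" using mult[OF one one] by simp
qed

text \<open>The root is the image under \<open>\<theta>\<close> of the complex number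
  \<open>cis (2 * pi / m)\<close>: coprimality of \<open>m\<close> and \<open>p\<close> puts it into
  the domain, and injectivity preserves its order. It supplies the roots for the Fourier argument on
  matrices.\<close>

lemma primitive_root_exists:
  fixes \<theta> :: "complex \<Rightarrow> 'f::field"
  assumes \<theta>: "root_correspondence p \<theta>" and m: "m > 0" "coprime m p"
  obtains w :: 'f where "w ^ m = 1" "\<And>i. 0 < i \<Longrightarrow> i < m \<Longrightarrow> w ^ i \<noteq> 1"
proof -
  define z where "z = cis (2 * pi / real m)"
  have z_pow: "z ^ i = cis (2 * pi * real i / real m)" for i
    by (simp add: z_def DeMoivre mult_ac)
  have zm: "z ^ m = 1" using m by (simp add: z_pow)
  have zi: "z ^ i \<noteq> 1" if "0 < i" "i < m" for i
  proof
    assume "z ^ i = 1"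
    \<comment> \<open>Writing 1 as the value at exponent 0 brings the equation under the injectivity
      of the parametrization of the \<open>m\<close>-th roots of unity by the numbers below
      \<open>m\<close>.\<close>
    then have "cis (2 * pi * real i / real m) = cis (2 * pi * real 0 / real m)"
      by (simp add: z_pow)
    then show False
      using bij_betw_roots_unity[OF m(1)] that unfolding bij_betw_def
      by (metis (no_types, lifting) inj_onD lessThan_iff m(1) less_irrefl)
  qed
  have z_carrier: "z ^ i \<in> carrier (roots_of_unity_prime_to p)" for i
    using zm m by (auto simp: roots_of_unity_prime_to_def intro!: exI[of _ m])
      (metis power_mult mult.commute power_one)
  note inj = root_correspondenceD(1)[OF \<theta>] and mult = root_correspondenceD(3)[OF \<theta>]
    and one = root_correspondenceD(5)[OF \<theta>]
  have pow: "\<theta> z ^ i = \<theta> (z ^ i)" for i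
    using mult[OF z_carrier[of 1] z_carrier] one by (induction i) auto
  show ?thesis
  proof (rule that[of "\<theta> z"])
    show "\<theta> z ^ m = 1" by (simp add: pow zm one)
    show "\<theta> z ^ i \<noteq> 1" if "0 < i" "i < m" for i
      using zi[OF that] inj_onD[OF inj _ z_carrier z_carrier, of i 0] by (auto simp: pow one)
  qed
qed

text \<open>The value at the identity is \<open>n\<close>, so equality forces all \<open>n\<close>
  lifted eigenvalues, and hence all eigenvalues of \<open>X g\<close>, to be 1. As the order of
  \<open>g\<close> is nonzero in the field, such a matrix is the identity.\<close>

lemma (in group) brauer_character_eq_one_iff:
  fixes X :: "'a \<Rightarrow> 'f::alg_closed_field mat"
  assumes p: "prime p" "CHAR('f) = p" and \<theta>: "root_correspondence p \<theta>"
    and X: "representation G n X" and g: "g \<in> p_regular p G"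
  shows "brauer_character p \<theta> G X g = brauer_character p \<theta> G X \<one> \<longleftrightarrow> X g = 1\<^sub>m n"
proof -
  let ?C = "carrier (roots_of_unity_prime_to p)" and ?inv = "inv_into (carrier (roots_of_unity_prime_to p)) \<theta>"
  have gG: "g \<in> carrier G" and ord: "\<not> p dvd ord g"
    using g by (auto simp: p_regular_def)
  have one_reg: "\<one> \<in> p_regular p G"
    using p by (auto simp: p_regular_def)
  note inj = root_correspondenceD(1)[OF \<theta>] and img = root_correspondenceD(2)[OF \<theta>]
    and one_C = root_correspondenceD(4)[OF \<theta>] and \<theta>_one = root_correspondenceD(5)[OF \<theta>]
  have inv_one: "?inv 1 = 1"
    using inv_into_f_f[OF inj one_C] \<theta>_one by simp
  have inv_C: "?inv x \<in> ?C" and \<theta>_inv: "\<theta> (?inv x) = x" if "x \<noteq> 0" for x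
    using that img by (auto intro: inv_into_into f_inv_into_f)
  have norm_C: "norm z = 1" if "z \<in> ?C" for z
    using that by (auto simp: roots_of_unity_prime_to_def)
      (metis norm_ge_zero norm_one norm_power power_eq_1_iff less_irrefl)
  have poly_nz: "char_poly A \<noteq> 0" and size: "size (proots (char_poly A)) = n"
    if "A \<in> carrier_mat n n" for A :: "'f mat"
    using degree_monic_char_poly[OF that] size_proots_alg_closed[of "char_poly A"] by force+
  have ev: "a \<in># proots (char_poly A) \<longleftrightarrow> eigenvalue A a" if "A \<in> carrier_mat n n" for A :: "'f mat" and a
    using poly_nz[OF that] eigenvalue_root_char_poly[OF that] by simp
  have at_one: "brauer_character p \<theta> G X \<one> = of_nat n"
  proof -
    have "x = 1" if "x \<in># proots (char_poly (1\<^sub>m n :: 'f mat))" for x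
    proof -
      have "eigenvalue (1\<^sub>m n) x" using ev that by simp
      then obtain v where "v \<in> carrier_vec n" "v \<noteq> 0\<^sub>v n" "v = x \<cdot>\<^sub>v v"
        by (auto simp: eigenvalue_def eigenvector_def)
      then obtain i where "i < n" "v $ i \<noteq> 0" "v $ i = x * v $ i"
        by (metis carrier_vecD eq_vecI index_smult_vec(1) index_zero_vec)
      then show "x = 1" by simp
    qed
    then have "?inv x = 1" if "x \<in># proots (char_poly (1\<^sub>m n :: 'f mat))" for x
      using that inv_one by metis
    then have "(\<Sum>x\<in>#proots (char_poly (1\<^sub>m n :: 'f mat)). ?inv x) = (\<Sum>x\<in>#proots (char_poly (1\<^sub>m n :: 'f mat)). 1)"
      by (intro arg_cong[where f = sum_mset] image_mset_cong)
    also have "\<dots> = of_nat n" using size[of "1\<^sub>m n"] by simp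
    finally show ?thesis
      using one_reg representation_one[OF is_group X] by (simp add: brauer_character_def)
  qed
  show ?thesis
  proof
    assume "X g = 1\<^sub>m n"
    then show "brauer_character p \<theta> G X g = brauer_character p \<theta> G X \<one>"
      using g one_reg representation_one[OF is_group X] by (simp add: brauer_character_def)
  next
    assume eq: "brauer_character p \<theta> G X g = brauer_character p \<theta> G X \<one>"
    have Xg: "X g \<in> carrier_mat n n" using representation_carrier[OF X gG] .
    \<comment> \<open>The map \<open>\<theta>\<close> reaches only nonzero field elements, so an
      eigenvalue can be lifted meaningfully only after 0 is excluded by invertibility.\<close>
    have ev_nz: "a \<noteq> 0" if "eigenvalue (X g) a" for a
    proof
      assume "a = 0"
      then obtain v where v: "v \<in> carrier_vec n" "v \<noteq> 0\<^sub>v n" "X g *\<^sub>v v = 0 \<cdot>\<^sub>v v"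
        using \<open>eigenvalue (X g) a\<close> Xg by (auto simp: eigenvalue_def eigenvector_def)
      then have "X g *\<^sub>v v = 0\<^sub>v n" by auto
      then have "v = X (inv g) *\<^sub>v 0\<^sub>v n"
        using representation_inv_vec(1)[OF is_group X gG v(1)] by simp
      then show False
        using v(2) mult_mat_vec_zero[OF representation_carrier[OF X inv_closed[OF gG]]] by simp
    qed
    have ev_one: "a = 1" if a: "eigenvalue (X g) a" for a
    proof -
      have "?inv a = 1"
      proof (rule sum_mset_unit_complex_eq_size[where f = ?inv and M = "proots (char_poly (X g))"])
        show "a \<in># proots (char_poly (X g))" using ev[OF Xg] a by simp
        show "norm (?inv x) = 1" if "x \<in># proots (char_poly (X g))" for x
          using that ev[OF Xg] ev_nz inv_C norm_C by blast
        show "(\<Sum>x\<in>#proots (char_poly (X g)). ?inv x) = of_nat (size (proots (char_poly (X g))))"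
          using eq at_one g size[OF Xg] by (simp add: brauer_character_def)
      qed
      then show ?thesis using \<theta>_inv[OF ev_nz[OF a]] \<theta>_one by simp
    qed
    \<comment> \<open>The order is 0 for elements of infinite order; \<open>p\<close> divides 0, so
      regularity excludes this case.\<close>
    have "ord g > 0" using ord by (metis dvd_0_right gr0I)
    moreover have "coprime (ord g) p"
      using ord p(1) by (metis coprime_commute prime_imp_coprime)
    ultimately obtain w :: 'f where "w ^ ord g = 1" "\<And>i. 0 < i \<Longrightarrow> i < ord g \<Longrightarrow> w ^ i \<noteq> 1"
      using primitive_root_exists[OF \<theta>] by blast
    moreover have "X g ^\<^sub>m ord g = 1\<^sub>m n"
      using representation_pow[OF is_group X gG, of "ord g"] gG representation_one[OF is_group X] by simp
    moreover have "(of_nat (ord g) :: 'f) \<noteq> 0"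
      using ord p(2) by (simp add: of_nat_eq_0_iff_char_dvd)
    ultimately show "X g = 1\<^sub>m n"
      using finite_order_mat_eq_one[OF Xg] ev_one by blast
  qed
qed

subsection \<open>The \<open>p\<close>-core of a quotient\<close>

text \<open>This is Lagrange inside \<open>M\<close>: the cosets of \<open>L\<close> by elements of
  \<open>M\<close> are the same sets whether formed in \<open>M\<close> or in
  \<open>G\<close>.\<close>

lemma (in group) card_rcosets_image:
  assumes L: "subgroup L G" and M: "subgroup M G" and "L \<subseteq> M"
  shows "card ((\<lambda>a. L #> a) ` M) * card L = card M"
proof -
  have "subgroup L (G\<lparr>carrier := M\<rparr>)" using subgroup_incl[OF assms] .
  moreover have "rcosets\<^bsub>G\<lparr>carrier := M\<rparr>\<^esub> L = (\<lambda>a. L #> a) ` M"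
    by (auto simp: RCOSETS_def r_coset_def)
  ultimately show ?thesis
    using group.lagrange[OF subgroup_imp_group[OF M], of L] by (simp add: Coset.order_def)
qed

text \<open>A subgroup \<open>N\<close> containing \<open>L\<close> is a union of cosets of
  \<open>L\<close>, so inclusion in it can be tested in the quotient.\<close>

lemma (in group) subgroup_le_if_rcosets_image_le:
  assumes L: "subgroup L G" and K: "subgroup K G" and N: "subgroup N G" "L \<subseteq> N"
    and sub: "(\<lambda>a. L #> a) ` K \<subseteq> (\<lambda>a. L #> a) ` N"
  shows "K \<subseteq> N"
proof
  fix x assume x: "x \<in> K"
  then obtain y where y: "y \<in> N" "L #> x = L #> y" using sub by blast
  have "x \<in> L #> y"
    using rcos_self[OF _ L, of x] x subgroup.subset[OF K] y(2) by blast
  then show "x \<in> N"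
    using y(1) N by (auto simp: r_coset_def intro: subgroup.m_closed)
qed

text \<open>\<open>GREATEST\<close> refers to inclusion of sets. The image of \<open>N\<close> is a
  normal \<open>p\<close>-subgroup, and any other one, \<open>R\<close>, is the image of its full
  preimage \<open>M\<close>, to which \<open>max\<close> applies.\<close>

lemma (in group) p_core_FactGroup_eq:
  assumes fin: "finite (carrier G)" and L: "L \<lhd> G" and N: "N \<lhd> G" "L \<subseteq> N"
    and card: "card N = p ^ k * card L"
    and max: "\<And>M j. M \<lhd> G \<Longrightarrow> L \<subseteq> M \<Longrightarrow> card M = p ^ j * card L \<Longrightarrow> M \<subseteq> N"
  shows "p_core p (G Mod L) = (\<lambda>a. L #> a) ` N"
proof -
  let ?q = "\<lambda>a. L #> a"
  interpret L: normal L G by (rule L)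
  interpret Q: group "G Mod L" by (rule L.factorgroup_is_group)
  interpret q: group_hom G "G Mod L" ?q
    using L.r_coset_hom_Mod by (intro group_hom.intro group_hom_axioms.intro is_group Q.is_group)
  have Lsub: "subgroup L G" by (rule L.subgroup_axioms)
  have "finite L" using fin L.subset finite_subset by blast
  then have L_pos: "card L > 0" using subgroup.one_closed[OF Lsub] card_gt_0_iff by blast
  have surj: "?q ` carrier G = carrier (G Mod L)" by (simp add: carrier_FactGroup)
  show ?thesis
    unfolding p_core_def
  proof (rule Greatest_equality)
    have "?q ` N \<lhd> G Mod L"
      using normal.surj_hom_normal_subgroup[OF N(1) q.group_hom_axioms surj] .
    moreover have "card (?q ` N) = p ^ k"
      using card_rcosets_image[OF Lsub normal_imp_subgroup[OF N(1)] N(2)] card L_pos by simp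
    ultimately show "?q ` N \<lhd> G Mod L \<and> (\<exists>k. card (?q ` N) = p ^ k)" by blast
  next
    fix R assume R: "R \<lhd> G Mod L \<and> (\<exists>k. card R = p ^ k)"
    then obtain j where j: "card R = p ^ j" by blast
    interpret R: normal R "G Mod L" using R by blast
    have R_one: "\<one>\<^bsub>G Mod L\<^esub> \<in> R" by (rule subgroup.one_closed[OF R.subgroup_axioms])
    define M where "M = {a \<in> carrier G. ?q a \<in> R}"
    have L_one: "?q a = \<one>\<^bsub>G Mod L\<^esub>" if "a \<in> L" for a
      using that L.rcos_const[OF is_group] by simp
    have "M \<lhd> G"
    proof (rule normal_invI)
      show "subgroup M G"
        by (rule subgroupI) (use R_one q.hom_one one_closed in \<open>auto simp: M_def simp del: one_FactGroup mult_FactGroup\<close>)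
      show "x \<otimes> h \<otimes> inv x \<in> M" if "x \<in> carrier G" "h \<in> M" for x h
        using that R.inv_op_closed2[of "?q x" "?q h"]
        by (auto simp: M_def simp del: mult_FactGroup)
    qed
    moreover have "L \<subseteq> M"
      using L_one R_one L.subset by (auto simp: M_def)
    moreover have RM: "R = ?q ` M"
      using R.subset unfolding surj[symmetric] M_def by blast
    moreover from calculation have "card M = p ^ j * card L"
      using card_rcosets_image[OF Lsub normal_imp_subgroup[OF \<open>M \<lhd> G\<close>]] j by simp
    ultimately have "M \<subseteq> N" using max by blast
    then show "R \<subseteq> ?q ` N" using RM by blast
  qed
qed

section \<open>Identification of \<open>brauer_K\<close> with the kernel\<close>

lemma (in group) brauer_K_eqI:
  assumes L: "subgroup (brauer_L p G \<phi>) G"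
    and N: "subgroup N G" "brauer_L p G \<phi> \<subseteq> N"
    and core: "p_core p (G Mod brauer_L p G \<phi>) = (\<lambda>a. brauer_L p G \<phi> #> a) ` N"
  shows "brauer_K p G \<phi> = N"
proof -
  \<comment> \<open>Shrinking the carrier to \<open>K\<close> leaves the multiplication unchanged,
    so the quotient of \<open>K\<close> consists of the cosets, formed in \<open>G\<close>, of
    elements of \<open>K\<close>.\<close>
  have carrier: "carrier ((G\<lparr>carrier := K\<rparr>) Mod brauer_L p G \<phi>) = (\<lambda>a. brauer_L p G \<phi> #> a) ` K" for K
    by (auto simp: carrier_FactGroup r_coset_def)
  show ?thesis
    unfolding brauer_K_def carrier core
  \<comment> \<open>A subgroup containing \<open>brauer_L\<close> is determined by its image in the
    quotient; both inclusions follow from testing on cosets.\<close>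
  proof (rule the_equality)
    fix K
    assume "subgroup K G \<and> brauer_L p G \<phi> \<subseteq> K \<and>
      (\<lambda>a. brauer_L p G \<phi> #> a) ` K = (\<lambda>a. brauer_L p G \<phi> #> a) ` N"
    then show "K = N"
      using N subgroup_le_if_rcosets_image_le[OF L, of K N]
        subgroup_le_if_rcosets_image_le[OF L, of N K] by auto
  qed (use N in simp)
qed

lemma (in group) brauer_L_normal_and_K_eq_kernel:
  fixes X :: "'a \<Rightarrow> 'f::alg_closed_field mat"
  assumes fin: "finite (carrier G)" and p: "prime p" "CHAR('f) = p"
    and \<theta>: "root_correspondence p \<theta>"
    and irr: "irreducible_representation G n X"
  defines "\<phi> \<equiv> brauer_character p \<theta> G X"
  shows "brauer_L p G \<phi> \<lhd> G" and "brauer_K p G \<phi> = {g \<in> carrier G. X g = 1\<^sub>m n}"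
proof -
  let ?L = "brauer_L p G \<phi>"
  define N where "N = {g \<in> carrier G. X g = 1\<^sub>m n}"
  have X: "representation G n X" using irr by (simp add: irreducible_representation_def)
  have N: "N \<lhd> G" unfolding N_def by (rule representation_kernel_normal[OF is_group X])
  interpret N: normal N G by (rule N)
  define S where "S = {g \<in> p_regular p G. \<phi> g = \<phi> \<one>}"
  have S: "S = N \<inter> p_regular p G"
  proof -
    have "\<phi> g = \<phi> \<one> \<longleftrightarrow> X g = 1\<^sub>m n" if "g \<in> p_regular p G" for g
      unfolding \<phi>_def using brauer_character_eq_one_iff[OF p \<theta> X that] .
    moreover have "p_regular p G \<subseteq> carrier G" by (auto simp: p_regular_def)
    ultimately show ?thesis unfolding S_def N_def by blast
  qed
  have L_eq: "?L = generate G S" by (simp add: brauer_L_def S_def)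
  show L: "?L \<lhd> G"
    unfolding L_eq
  proof (rule normal_generateI)
    show "S \<subseteq> carrier G" using S N.subset by blast
    fix h g assume h: "h \<in> S" and g: "g \<in> carrier G"
    then have hG: "h \<in> carrier G" using S N.subset by blast
    \<comment> \<open>Conjugation commutes with powers, hence preserves orders and
      \<open>p\<close>-regularity. This makes the generating set \<open>S\<close> closed under
      conjugation.\<close>
    have pow: "(g \<otimes> h \<otimes> inv g) [^] i = g \<otimes> h [^] i \<otimes> inv g" for i :: nat
    proof (induction i)
      case (Suc i)
      have "g \<otimes> h [^] i \<otimes> inv g \<otimes> (g \<otimes> h \<otimes> inv g) = g \<otimes> h [^] i \<otimes> (inv g \<otimes> g) \<otimes> h \<otimes> inv g"
        using g hG by (simp only: m_assoc m_closed inv_closed nat_pow_closed)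
      then show ?case using Suc g hG by (simp add: m_assoc)
    qed (use g in simp)
    have "(g \<otimes> h \<otimes> inv g) [^] i = \<one> \<longleftrightarrow> h [^] i = \<one>" for i :: nat
      using g hG unfolding pow
      by (metis inv_closed inv_solve_right l_cancel_one' m_closed nat_pow_closed one_closed r_cancel_one r_one l_one inv_inv)
    then have "ord (g \<otimes> h \<otimes> inv g) = ord h"
      using g hG by (metis (no_types, lifting) dvd_antisym dvd_refl inv_closed m_closed pow_eq_id)
    then show "g \<otimes> h \<otimes> inv g \<in> S"
      using h g hG N.inv_op_closed2[OF g] by (auto simp: S p_regular_def)
  qed
  interpret L: normal ?L G by (rule L)
  have LN: "?L \<subseteq> N"
    unfolding L_eq using S by (intro generate_subgroup_incl N.subgroup_axioms) auto
  interpret NG: group "G\<lparr>carrier := N\<rparr>" using subgroup_imp_group[OF N.subgroup_axioms] .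
  have "\<exists>k. order (G\<lparr>carrier := N\<rparr>) = p ^ k * card ?L"
  proof (rule NG.p_index_if_p_regular_subset[OF _ p(1)])
    show "finite (carrier (G\<lparr>carrier := N\<rparr>))" using fin N.subset finite_subset by auto
    show "subgroup ?L (G\<lparr>carrier := N\<rparr>)"
      using subgroup_incl[OF L.subgroup_axioms N.subgroup_axioms LN] .
    fix g assume g: "g \<in> carrier (G\<lparr>carrier := N\<rparr>)" "\<not> p dvd NG.ord g"
    then have gG: "g \<in> carrier G" using N.subset by auto
    \<comment> \<open>Orders in \<open>N\<close> and in \<open>G\<close> divide the same exponents
      and so coincide, which transfers \<open>p\<close>-regularity from \<open>N\<close> to
      \<open>G\<close>.\<close>
    have "NG.ord g dvd i \<longleftrightarrow> ord g dvd i" for i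
      using NG.pow_eq_id[OF g(1), of i] pow_eq_id[OF gG, of i] nat_pow_consistent[of g i N] by simp
    then have "NG.ord g = ord g" by (meson dvd_antisym dvd_refl)
    then have "g \<in> S" using g gG by (auto simp: S p_regular_def)
    then show "g \<in> ?L" unfolding L_eq by (rule generate.incl)
  qed
  then obtain k where card_N: "card N = p ^ k * card ?L" by (auto simp: Coset.order_def)
  have trivial: "X h = 1\<^sub>m n" if "h \<in> ?L" for h using that LN unfolding N_def by blast
  have "p_core p (G Mod ?L) = (\<lambda>a. ?L #> a) ` N"
  proof (rule p_core_FactGroup_eq[OF fin L N LN card_N])
    fix M j assume M: "M \<lhd> G" "?L \<subseteq> M" "card M = p ^ j * card ?L"
    have "prime CHAR('f)" "card M = CHAR('f) ^ j * card ?L"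
      unfolding p(2) by (fact p(1), fact M(3))
    then have "X m = 1\<^sub>m n" if "m \<in> M" for m
      using irreducible_trivial_on_normal_p_extension[OF fin _ irr M(1) L.subgroup_axioms M(2) trivial _ that]
      by blast
    then show "M \<subseteq> N"
      using subgroup.subset[OF normal_imp_subgroup[OF M(1)]] unfolding N_def by blast
  qed
  then show "brauer_K p G \<phi> = {g \<in> carrier G. X g = 1\<^sub>m n}"
    unfolding N_def[symmetric] by (rule brauer_K_eqI[OF L.subgroup_axioms N.subgroup_axioms LN])
qed

theorem theorem1:
  fixes G :: "('a, 'b) monoid_scheme"
    and p :: nat
    and \<theta> :: "complex \<Rightarrow> 'f::alg_closed_field"
    and \<phi> :: "'a \<Rightarrow> complex"
  assumes "group G" and "finite (carrier G)"
    and "prime p" and "CHAR('f) = p"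
    and "root_correspondence p \<theta>"
    and "\<phi> \<in> IBr p \<theta> G"
  shows "brauer_L p G \<phi> \<lhd> G \<and> brauer_K p G \<phi> = brauer_kernel p \<theta> G \<phi>"
proof -
  obtain n X where irr: "irreducible_representation G n X" and \<phi>: "\<phi> = brauer_character p \<theta> G X"
    using assms(6) by (auto simp: IBr_def)
  note main = group.brauer_L_normal_and_K_eq_kernel[OF assms(1-5)]
  \<comment> \<open>Every irreducible representation affording \<open>\<phi>\<close> has kernel
    \<open>brauer_K p G \<phi>\<close>, which is computed from \<open>\<phi>\<close> alone. This
    gives existence and uniqueness for the definite description.\<close>
  have "brauer_kernel p \<theta> G \<phi> = brauer_K p G \<phi>"
    unfolding brauer_kernel_def
  proof (rule the_equality)
    show "\<exists>n X. irreducible_representation G n X \<and> brauer_character p \<theta> G X = \<phi> \<and>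
        brauer_K p G \<phi> = {g \<in> carrier G. X g = 1\<^sub>m n}"
      using irr \<phi> main(2)[OF irr] by blast
  qed (use main(2) in blast)
  then show ?thesis using main(1)[OF irr] \<phi> by simp
qed

end
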